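(* Let $R$ be a commutative ring with unity, let $\{a_n\}_{n\ge 0}$ be a sequence of elements of $R$ such that $a_0$ is invertible, and let $S=\sum_{i\ge 0}a_iX^i\in R[[X]]$. Put $\mathcal{X}_0=1$ and, for $n\ge 1$, let $\mathcal{X}_n=\delta(-X,a_1,\ldots,a_n)\in R[X]$ be the determinant of the $n\times n$ matrix whose $(i,j)$ entry is $a_{j-i+1}$ if $j\ge i$, $-X$ if $i=j+1$, and $0$ if $i>j+1$. Then for every integer $k$, $$S^{k}=\sum_{i\geq 0}[\mathcal{X}_{i}]_{k}^{i}(a_{0})\,X^{i}.$$ Moreover, for every $n\ge 1$, $$\delta(-X, a_{1}, \ldots, a_{n})=\sum_{\substack{k_1+k_2+\cdots+k_n=l \\ k_1+2k_2+\cdots+nk_n=n}}l!\,\frac{a_{1}^{k_1}a_{2}^{k_2}\cdots a_{n}^{k_n}}{k_1!k_2!\cdots k_n!}X^{n-l},$$ and, more explicitly, $$[\mathcal{X}_{n}]_{k}^{n}(a_{0})=\sum_{\substack{k_1+k_2+\cdots+k_n=l \\ k_1+2k_2+\cdots+nk_n=n}}k(k-1)\cdots(k-l+1)\,\frac{a_{1}^{k_1}a_{2}^{k_2}\cdots a_{n}^{k_n}}{k_1!k_2!\cdots k_n!}\,a_{0}^{k-l}.$$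
   Context: For integers $k,r$, $[\,\cdot\,]_k^r: R[X]\to R[X,X^{-1}]$ is the $R$-linear map with $[X^i]_k^r=\binom{k}{r-i}X^{k-(r-i)}$ for $i\ge 0$. Here $\binom{k}{p}=k(k-1)\cdots(k-p+1)/p!$ for $p\ge 0$ and any integer $k$, and $\binom{k}{p}=0$ for $p<0$; in particular, for $0\le k\le p$, $X^{k-p}\binom{k}{p}$ equals $1$ if $k=p$ and $0$ otherwise. $[P]_k^r(a_0)$ denotes the evaluation of $[P]_k^r$ at $X=a_0$. The sums run over all tuples $(k_1,\ldots,k_n)$ of nonnegative integers with $k_1+2k_2+\cdots+nk_n=n$, and $l=k_1+\cdots+k_n$ is determined by the tuple. The integers $\frac{l!}{k_1!\cdots k_n!}$ and $\frac{k(k-1)\cdots(k-l+1)}{k_1!\cdots k_n!}=\binom{k}{l}\frac{l!}{k_1!\cdots k_n!}$ are regarded as elements of $R$. *)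

theory Defs
  imports
    "HOL-Computational_Algebra.Formal_Power_Series"
    "HOL-Library.Poly_Mapping"
    "Jordan_Normal_Form.Determinant"
begin

text \<open>Integer powers of units of an arbitrary commutative ring. The library operation
  \<open>powi\<close> needs the class \<open>inverse\<close>, which is available neither for such a ring nor for power
  series over it. Only meaningful for negative exponents if \<open>x dvd 1\<close>.\<close>

definition unit_inv :: "'a::comm_ring_1 \<Rightarrow> 'a" where
  "unit_inv x = (THE y. x * y = 1)"

definition unit_powi :: "'a::comm_ring_1 \<Rightarrow> int \<Rightarrow> 'a" where
  "unit_powi x k = (if k \<ge> 0 then x ^ nat k else unit_inv x ^ nat (- k))"

lemma unit_inv_unique:
  fixes x :: "'a::comm_ring_1"
  assumes "x * y = 1"
  shows "unit_inv x = y"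
  unfolding unit_inv_def
proof (rule the_equality)
  fix z assume "x * z = 1"
  then have "z = (x * y) * z" using assms by simp
  also have "\<dots> = y * (x * z)" by (simp add: ac_simps)
  finally show "z = y" using \<open>x * z = 1\<close> by simp
qed (fact assms)

lemma unit_inv_right: "x dvd 1 \<Longrightarrow> x * unit_inv x = (1 :: 'a::comm_ring_1)"
  by (metis dvdE unit_inv_unique)

text \<open>Laurent polynomials are finitely supported functions from integer exponents to
  coefficients; the library's convolution product makes this type the ring $R[X,X^{-1}]$.\<close>

type_synonym 'a laurent_poly = "int \<Rightarrow>\<^sub>0 'a"

definition laurent_eval :: "'a::comm_ring_1 laurent_poly \<Rightarrow> 'a \<Rightarrow> 'a" where
  "laurent_eval f x = (\<Sum>e\<in>Poly_Mapping.keys f. Poly_Mapping.lookup f e * unit_powi x e)"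

text \<open>The division is exact. This is \<open>gchoose\<close> on the integers, written out because
  the imported theories restrict the syntactic sort of \<open>gchoose\<close> to fields.\<close>

definition int_binom :: "int \<Rightarrow> int \<Rightarrow> int" where
  "int_binom k p = (if p \<ge> 0 then (\<Prod>j<nat p. k - int j) div fact (nat p) else 0)"

text \<open>The map $[P]_k^r$, obtained by extending its values on monomials linearly.\<close>

definition bracket :: "int \<Rightarrow> int \<Rightarrow> 'a::comm_ring_1 poly \<Rightarrow> 'a laurent_poly" where
  "bracket k r P =
    (\<Sum>i\<le>degree P. Poly_Mapping.single (k - (r - int i))
        (poly.coeff P i * of_int (int_binom k (r - int i))))"

lemma bracket_altdef:
  assumes "degree P \<le> N"
  shows "bracket k r P =
    (\<Sum>i\<le>N. Poly_Mapping.single (k - (r - int i))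
        (poly.coeff P i * of_int (int_binom k (r - int i))))"
  unfolding bracket_def
  by (rule sum.mono_neutral_left) (use assms in \<open>auto simp: coeff_eq_0\<close>)

lemma bracket_monom:
  "bracket k r (monom c i) =
    Poly_Mapping.single (k - (r - int i)) (c * of_int (int_binom k (r - int i)))"
proof -
  have "bracket k r (monom c i) =
    (\<Sum>j\<le>i. if j = i then
        Poly_Mapping.single (k - (r - int i)) (c * of_int (int_binom k (r - int i))) else 0)"
    by (subst bracket_altdef[OF degree_monom_le]) (rule sum.cong, auto)
  then show ?thesis by simp
qed

lemma bracket_add: "bracket k r (P + Q) = bracket k r P + bracket k r Q"
proof -
  define N where "N = max (degree P) (degree Q)"
  have "degree P \<le> N" "degree Q \<le> N" "degree (P + Q) \<le> N"
    by (simp_all add: N_def degree_add_le_max)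
  then show ?thesis
    by (simp add: bracket_altdef[where N = N] sum.distrib[symmetric] single_add[symmetric]
        algebra_simps)
qed

text \<open>The matrix has 0-based indices, which does not affect the entries since these
  depend on $j-i$ only.\<close>

definition hess_det :: "'a::comm_ring_1 \<Rightarrow> (nat \<Rightarrow> 'a) \<Rightarrow> nat \<Rightarrow> 'a" where
  "hess_det x b n =
    det (mat n n (\<lambda>(i, j). if j \<ge> i then b (j - i + 1) else if i = j + 1 then x else 0))"

definition delta_poly :: "(nat \<Rightarrow> 'a::comm_ring_1) \<Rightarrow> nat \<Rightarrow> 'a poly" where
  "delta_poly a n = hess_det (- [:0, 1:]) (\<lambda>m. [:a m:]) n"

definition calX :: "(nat \<Rightarrow> 'a::comm_ring_1) \<Rightarrow> nat \<Rightarrow> 'a poly" where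
  "calX a n = (if n = 0 then 1 else delta_poly a n)"

text \<open>A tuple $(k_1,\ldots,k_n)$ is a function on the naturals vanishing outside
  \<open>{1..n}\<close>, so that each tuple is represented exactly once.\<close>

definition weighted_tuples :: "nat \<Rightarrow> (nat \<Rightarrow> nat) set" where
  "weighted_tuples n =
    {\<kappa>. (\<forall>i. i \<notin> {1..n} \<longrightarrow> \<kappa> i = 0) \<and> (\<Sum>i=1..n. i * \<kappa> i) = n}"

definition tuple_size :: "nat \<Rightarrow> (nat \<Rightarrow> nat) \<Rightarrow> nat" where
  "tuple_size n \<kappa> = (\<Sum>i=1..n. \<kappa> i)"

lemma finite_weighted_tuples: "finite (weighted_tuples n)"
proof (rule finite_subset)
  show "weighted_tuples n \<subseteq>
    {\<kappa>. \<forall>i. (i \<in> {1..n} \<longrightarrow> \<kappa> i \<in> {..n}) \<and> (i \<notin> {1..n} \<longrightarrow> \<kappa> i = 0)}"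
  proof (clarsimp simp: weighted_tuples_def)
    fix \<kappa> :: "nat \<Rightarrow> nat" and i
    assume s: "(\<Sum>i = Suc 0..n. i * \<kappa> i) = n" and i: "Suc 0 \<le> i" "i \<le> n"
    have "\<kappa> i \<le> i * \<kappa> i" using i by simp
    also have "\<dots> \<le> (\<Sum>i = Suc 0..n. i * \<kappa> i)"
      by (rule member_le_sum) (use i in auto)
    finally show "\<kappa> i \<le> n" using s by simp
  qed
  show "finite {\<kappa>. \<forall>i. (i \<in> {1..n} \<longrightarrow> \<kappa> i \<in> {..n}) \<and> (i \<notin> {1..n} \<longrightarrow> \<kappa> i = (0::nat))}"
    by (rule finite_set_of_finite_funs) auto
qed

lemma tuple_size_le: "\<kappa> \<in> weighted_tuples n \<Longrightarrow> tuple_size n \<kappa> \<le> n"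
proof -
  assume "\<kappa> \<in> weighted_tuples n"
  then have s: "(\<Sum>i=1..n. i * \<kappa> i) = n" by (simp add: weighted_tuples_def)
  have "tuple_size n \<kappa> \<le> (\<Sum>i=1..n. i * \<kappa> i)"
    unfolding tuple_size_def by (rule sum_mono) auto
  then show ?thesis using s by simp
qed

end

theory Submission imports Defs begin

text \<open>
  Write $S = a_0 + T$, where $T$ has constant term $0$, and let $c(n,l)$ be the coefficient of
  $X^n$ in $T^l$; it vanishes for $l > n$. Everything is expressed through these numbers.

  The determinants satisfy $\mathcal{X}_{m+1} = \sum_{j \le m} a_{j+1} X^j \mathcal{X}_{m-j}$
  (\<open>hess_det_Suc\<close>), while $T^{l+1} = T \cdot T^l$ gives
  $c(m+1,l+1) = \sum_{j \le m} a_{j+1}\, c(m-j,l)$. Comparing the two recurrences yields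
  $\mathcal{X}_n = \sum_l c(n,l) X^{n-l}$ (\<open>calX_eq_sum\<close>). So the coefficient of $X^{n-l}$ in
  $\mathcal{X}_n$ is $c(n,l)$, and the bracket sends it to $\binom{k}{l} c(n,l) a_0^{k-l}$: the
  value $[\mathcal{X}_n]_k^n(a_0)$ is the coefficient of $X^n$ in the binomial series
  $\sum_l \binom{k}{l} a_0^{k-l} T^l$ (\<open>laurent_eval_bracket_calX\<close>).

  That this series is $S^k$ for $k$ of either sign comes from Pascal's rule. Denoting the series
  by $F_k$, the rule gives $F_{k+1} = S \cdot F_k$ for all integers
  $k$, and $F_0 = 1$. In particular $F_{-1}$ is an inverse of $S$, and a family
  indexed by the integers with these two properties is the family of integer powers
  (\<open>unit_powi_unique\<close>).

  The explicit formulas follow from the multinomial theorem applied to $T^l$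
  (\<open>tail_fps_power_nth\<close>): $c(n,l)$ collects the tuples $(k_1,\ldots,k_n)$ with
  $\sum k_i = l$ and $\sum i k_i = n$.
\<close>

unbundle fps_syntax

section \<open>Determinants of Hessenberg matrices\<close>

text \<open>The Hessenberg matrix with an arbitrary first row. Expanding along the first column deletes
  one of the first two rows, so this larger family is closed under the expansion, while the
  Toeplitz matrices of \<open>hess_det\<close> are not.\<close>

definition hess_row_mat :: "(nat \<Rightarrow> 'a) \<Rightarrow> 'a::comm_ring_1 \<Rightarrow> (nat \<Rightarrow> 'a) \<Rightarrow> nat \<Rightarrow> 'a mat" where
  "hess_row_mat c x b n =
    mat n n (\<lambda>(i, j). if i = 0 then c j else if j \<ge> i then b (j - i + 1)
                      else if i = j + 1 then x else 0)"

lemma hess_row_mat_carrier [simp]: "hess_row_mat c x b n \<in> carrier_mat n n"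
  by (simp add: hess_row_mat_def)

lemma hess_det_eq_hess_row_mat: "hess_det x b n = det (hess_row_mat (\<lambda>j. b (j + 1)) x b n)"
  unfolding hess_det_def hess_row_mat_def by (rule arg_cong[where f = det]) auto

text \<open>Expansion along the first column, whose entries below the second one vanish. Deleting
  the second row together with the first column keeps the first row, shifted by one place.\<close>

lemma det_hess_row_mat_Suc_Suc:
  "det (hess_row_mat c x b (Suc (Suc n))) =
     c 0 * hess_det x b (Suc n) - x * det (hess_row_mat (\<lambda>j. c (Suc j)) x b (Suc n))"
proof -
  let ?A = "hess_row_mat c x b (Suc (Suc n))"
  have del0: "mat_delete ?A 0 0 = hess_row_mat (\<lambda>j. b (j + 1)) x b (Suc n)"
    by (rule eq_matI) (auto simp: mat_delete_def hess_row_mat_def)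
  have del1: "mat_delete ?A (Suc 0) 0 = hess_row_mat (\<lambda>j. c (Suc j)) x b (Suc n)"
    by (rule eq_matI) (auto simp: mat_delete_def hess_row_mat_def)
  have "det ?A = (\<Sum>i<Suc (Suc n). ?A $$ (i, 0) * cofactor ?A i 0)"
    by (rule laplace_expansion_column) auto
  also have "\<dots> = ?A $$ (0, 0) * cofactor ?A 0 0 + ?A $$ (Suc 0, 0) * cofactor ?A (Suc 0) 0"
    by (simp add: sum.lessThan_Suc_shift hess_row_mat_def del: sum.lessThan_Suc)
  also have "\<dots> = c 0 * hess_det x b (Suc n) - x * det (hess_row_mat (\<lambda>j. c (Suc j)) x b (Suc n))"
    unfolding cofactor_def del0 del1 hess_det_eq_hess_row_mat by (simp add: hess_row_mat_def)
  finally show ?thesis .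
qed

lemma det_hess_row_mat:
  "det (hess_row_mat c x b (Suc n)) = (\<Sum>j\<le>n. (- x) ^ j * c j * hess_det x b (n - j))"
proof (induction n arbitrary: c)
  case 0
  have "hess_det x b 0 = 1"
    by (simp add: hess_det_def)
  then show ?case
    by (simp add: det_single hess_row_mat_def)
next
  case (Suc n)
  show ?case
    unfolding det_hess_row_mat_Suc_Suc Suc.IH
    by (simp add: sum.atMost_Suc_shift sum_distrib_left mult_ac sum_negf del: sum.atMost_Suc)
qed

text \<open>The recurrence that an expansion along the first row would give: the minor belonging to
  column \<open>j\<close> is block triangular, with a \<open>j \<times> j\<close> triangular block having \<open>x\<close> on its
  diagonal and a smaller matrix of the same kind. Iterating the column expansion reaches it
  without block matrices.\<close>

lemma hess_det_Suc:
  "hess_det x b (Suc n) = (\<Sum>j\<le>n. (- x) ^ j * b (Suc j) * hess_det x b (n - j))"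
  using det_hess_row_mat[of "\<lambda>j. b (j + 1)" x b n]
  by (simp add: hess_det_eq_hess_row_mat[of x b "Suc n"])

lemma hess_det_0: "hess_det x b 0 = 1"
  by (simp add: hess_det_def)

section \<open>Powers of the non-constant part of a power series\<close>

definition tail_fps :: "(nat \<Rightarrow> 'a::comm_ring_1) \<Rightarrow> 'a fps" where
  "tail_fps a = Abs_fps (\<lambda>n. if n = 0 then 0 else a n)"

lemma Abs_fps_eq_const_plus_tail: "Abs_fps a = fps_const (a 0) + tail_fps a"
  by (simp add: fps_eq_iff tail_fps_def)

lemma tail_fps_power_Suc_nth_Suc:
  "(tail_fps a ^ Suc l) $ Suc n = (\<Sum>j\<le>n. a (Suc j) * (tail_fps a ^ l) $ (n - j))"
  by (simp add: fps_mult_nth atLeast0AtMost sum.atMost_Suc_shift tail_fps_def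
        del: sum.atMost_Suc)

lemma tail_fps_power_nth_0: "(tail_fps a ^ l) $ 0 = (if l = 0 then 1 else 0)"
  by (cases l) (simp_all add: tail_fps_def)

lemma tail_fps_power_nth_eq_0: "n < l \<Longrightarrow> (tail_fps a ^ l) $ n = 0"
proof (induction l arbitrary: n)
  case (Suc l)
  then show ?case
    by (cases n) (simp_all add: tail_fps_power_nth_0 tail_fps_power_Suc_nth_Suc del: power_Suc)
qed simp

text \<open>Both sides satisfy the same recurrence: multiplying by $T$ raises the exponent \<open>l\<close> by one and
  shifts the index \<open>n\<close> by the index of the coefficient used, exactly as the expansion of the
  determinant does.\<close>

lemma calX_eq_sum:
  "calX a n = (\<Sum>l\<le>n. monom ((tail_fps a ^ l) $ n) (n - l))"
proof (induction n rule: less_induct)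
  case (less n)
  show ?case
  proof (cases n)
    case 0
    then show ?thesis by (simp add: calX_def)
  next
    case (Suc m)
    have calX_hess: "calX a i = hess_det (- [:0, 1:]) (\<lambda>m. [:a m:]) i" for i
      by (simp add: calX_def delta_poly_def hess_det_0)
    let ?T = "tail_fps a"
    have "calX a n = (\<Sum>j\<le>m. monom (a (Suc j)) j * calX a (m - j))"
      unfolding calX_hess Suc hess_det_Suc
      by (intro sum.cong) (simp_all add: monom_altdef mult_ac)
    also have "\<dots> = (\<Sum>j\<le>m. \<Sum>l\<le>m - j. monom (a (Suc j) * (?T ^ l) $ (m - j)) (m - l))"
      by (intro sum.cong refl, subst less.IH)
         (auto simp: Suc sum_distrib_left mult_monom intro!: sum.cong)
    \<comment> \<open>Extending the inner range to all $l \le m$ adds only zeros and allows the sums to be swapped.\<close>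
    also have "\<dots> = (\<Sum>j\<le>m. \<Sum>l\<le>m. monom (a (Suc j) * (?T ^ l) $ (m - j)) (m - l))"
      by (intro sum.cong refl sum.mono_neutral_left) (auto simp: tail_fps_power_nth_eq_0)
    also have "\<dots> = (\<Sum>l\<le>m. \<Sum>j\<le>m. monom (a (Suc j) * (?T ^ l) $ (m - j)) (m - l))"
      by (rule sum.swap)
    also have "\<dots> = (\<Sum>l\<le>m. monom ((?T ^ Suc l) $ n) (m - l))"
      unfolding Suc tail_fps_power_Suc_nth_Suc by (simp add: monom_sum)
    \<comment> \<open>The new term $l = 0$ vanishes, since $T^0 = 1$ has no coefficient at the positive index $n$.\<close>
    also have "\<dots> = (\<Sum>l\<le>n. monom ((?T ^ l) $ n) (n - l))"
      unfolding Suc by (simp add: sum.atMost_Suc_shift del: sum.atMost_Suc power_Suc)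
    finally show ?thesis .
  qed
qed

section \<open>The multinomial theorem\<close>

lemma prod_fact_dvd_fact_sum:
  assumes "finite A"
  shows "(\<Prod>i\<in>A. fact (\<kappa> i) :: nat) dvd fact (\<Sum>i\<in>A. \<kappa> i)"
  using assms
proof (induction A rule: finite_induct)
  case (insert x A)
  have "fact (\<kappa> x) * (\<Prod>i\<in>A. fact (\<kappa> i) :: nat) dvd fact (\<kappa> x) * fact (\<Sum>i\<in>A. \<kappa> i)"
    using insert.IH by (intro mult_dvd_mono) auto
  also have "\<dots> dvd fact (\<kappa> x + (\<Sum>i\<in>A. \<kappa> i))"
    by (rule fact_fact_dvd_fact)
  finally show ?case using insert.hyps by simp
qed simp

text \<open>Vanishing outside \<open>A\<close> makes each composition a unique function, in the same way as for
  \<open>weighted_tuples\<close>.\<close>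

definition weak_compositions :: "nat \<Rightarrow> 'i set \<Rightarrow> ('i \<Rightarrow> nat) set" where
  "weak_compositions l A = {\<kappa>. (\<forall>i. i \<notin> A \<longrightarrow> \<kappa> i = 0) \<and> (\<Sum>i\<in>A. \<kappa> i) = l}"

lemma finite_weak_compositions:
  assumes "finite A" shows "finite (weak_compositions l A)"
proof (rule finite_subset)
  show "weak_compositions l A \<subseteq> {\<kappa>. \<forall>i. (i \<in> A \<longrightarrow> \<kappa> i \<in> {..l}) \<and> (i \<notin> A \<longrightarrow> \<kappa> i = 0)}"
    using assms by (auto simp: weak_compositions_def intro: member_le_sum)
  show "finite {\<kappa>. \<forall>i. (i \<in> A \<longrightarrow> \<kappa> i \<in> {..l}) \<and> (i \<notin> A \<longrightarrow> \<kappa> i = (0::nat))}"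
    using assms by (intro finite_set_of_finite_funs) auto
qed

text \<open>Splitting off the part at the new index is the induction step for sums over weak compositions.\<close>

lemma sum_weak_compositions_insert:
  assumes "finite A" "x \<notin> A"
  shows "(\<Sum>\<kappa>\<in>weak_compositions l (insert x A). g \<kappa>) =
    (\<Sum>k\<le>l. \<Sum>\<kappa>\<in>weak_compositions (l - k) A. g (\<kappa>(x := k)))"
proof -
  have sum_upd: "(\<Sum>i\<in>A. if i = x then k else \<kappa> i) = sum \<kappa> A" for \<kappa> :: "'a \<Rightarrow> nat" and k
    using assms by (intro sum.cong) auto
  have "(\<Sum>k\<le>l. \<Sum>\<kappa>\<in>weak_compositions (l - k) A. g (\<kappa>(x := k))) =
      (\<Sum>(k, \<kappa>)\<in>(SIGMA k:{..l}. weak_compositions (l - k) A). g (\<kappa>(x := k)))"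
    using assms by (subst sum.Sigma) (auto simp: finite_weak_compositions)
  also have "\<dots> = (\<Sum>\<kappa>\<in>weak_compositions l (insert x A). g \<kappa>)"
    by (rule sum.reindex_bij_witness[where
          i = "\<lambda>\<kappa>. (\<kappa> x, \<kappa>(x := 0))" and j = "\<lambda>(k, \<kappa>). \<kappa>(x := k)"])
       (use assms in \<open>auto simp: weak_compositions_def sum_upd fun_eq_iff\<close>)
  finally show ?thesis by simp
qed

lemma fact_div_fact_mult:
  assumes "P dvd fact (l - k)" "k \<le> l"
  shows "fact l div (fact k * P) = (l choose k) * (fact (l - k) div P :: nat)"
proof -
  have "fact l = fact k * fact (l - k) * (l choose k)"
    using binomial_fact_lemma[OF assms(2)] by simp
  then show ?thesis
    using assms(1) by (auto simp: dvd_def mult_ac)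
qed

lemma prod_insert_fun_upd:
  assumes "finite A" "x \<notin> A"
  shows "(\<Prod>i\<in>insert x A. h i ((\<kappa>(x := k)) i)) = h x k * (\<Prod>i\<in>A. h i (\<kappa> i))"
  using assms by (auto intro!: arg_cong2[where f = "(*)"] prod.cong)

text \<open>Induction on the number of summands, with the binomial theorem as the step. The exact division
  keeps the coefficient a natural number, so that the identity makes sense in a ring of any
  characteristic.\<close>

lemma multinomial_theorem:
  fixes f :: "'i \<Rightarrow> 'a::comm_ring_1"
  assumes "finite A"
  shows "(\<Sum>i\<in>A. f i) ^ l =
    (\<Sum>\<kappa>\<in>weak_compositions l A. of_nat (fact l div (\<Prod>i\<in>A. fact (\<kappa> i))) * (\<Prod>i\<in>A. f i ^ \<kappa> i))"
  using assms
proof (induction A arbitrary: l rule: finite_induct)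
  case empty
  have "weak_compositions l ({} :: 'i set) = (if l = 0 then {\<lambda>_. 0} else {})"
    by (auto simp: weak_compositions_def)
  then show ?case by (simp add: power_0_left)
next
  case (insert x A)
  note prod_upd = prod_insert_fun_upd[OF insert.hyps]
  have "(\<Sum>i\<in>insert x A. f i) ^ l =
      (\<Sum>k\<le>l. of_nat (l choose k) * f x ^ k * (\<Sum>i\<in>A. f i) ^ (l - k))"
    using insert.hyps by (simp add: binomial_ring)
  also have "\<dots> = (\<Sum>k\<le>l. \<Sum>\<kappa>\<in>weak_compositions (l - k) A.
      of_nat (fact l div (\<Prod>i\<in>insert x A. fact ((\<kappa>(x := k)) i))) *
        (\<Prod>i\<in>insert x A. f i ^ ((\<kappa>(x := k)) i)))"
  proof (intro sum.cong refl)
    fix k assume k: "k \<in> {..l}"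
    have "fact l div (\<Prod>i\<in>insert x A. fact ((\<kappa>(x := k)) i)) =
        (l choose k) * (fact (l - k) div (\<Prod>i\<in>A. fact (\<kappa> i)) :: nat)"
      if "\<kappa> \<in> weak_compositions (l - k) A" for \<kappa>
      unfolding prod_upd[where h = "\<lambda>i. fact"]
      using that k prod_fact_dvd_fact_sum[OF insert.hyps(1), of \<kappa>]
      by (intro fact_div_fact_mult) (auto simp: weak_compositions_def)
    then show "of_nat (l choose k) * f x ^ k * (\<Sum>i\<in>A. f i) ^ (l - k) =
      (\<Sum>\<kappa>\<in>weak_compositions (l - k) A.
        of_nat (fact l div (\<Prod>i\<in>insert x A. fact ((\<kappa>(x := k)) i))) *
        (\<Prod>i\<in>insert x A. f i ^ ((\<kappa>(x := k)) i)))"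
      unfolding insert.IH sum_distrib_left prod_upd[where h = "\<lambda>i m. f i ^ m"]
      by (intro sum.cong) (simp_all add: mult_ac)
  qed
  finally show ?case
    by (simp only: sum_weak_compositions_insert[OF insert.hyps])
qed

lemma fps_power_nth_cong:
  fixes f g :: "'a::comm_ring_1 fps"
  assumes "\<And>i. i \<le> n \<Longrightarrow> f $ i = g $ i" "m \<le> n"
  shows "(f ^ l) $ m = (g ^ l) $ m"
  using assms(2)
proof (induction l arbitrary: m)
  case (Suc l)
  then show ?case
    using assms(1) by (auto simp: fps_mult_nth intro!: sum.cong)
qed simp

lemma fps_const_prod: "fps_const (\<Prod>i\<in>A. f i) = (\<Prod>i\<in>A. fps_const (f i :: 'a::comm_ring_1))"
  by (induction A rule: infinite_finite_induct) (simp_all flip: fps_const_mult)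

text \<open>Only the first \<open>n\<close> terms of $T$ influence the coefficient of $X^n$ in $T^l$, so $T$ may be
  replaced by the finite sum $\sum_{i=1}^n a_i X^i$. A tuple then contributes a monomial of
  degree $\sum i k_i$.\<close>

lemma tail_fps_power_nth:
  "(tail_fps a ^ l) $ n =
    (\<Sum>\<kappa> | \<kappa> \<in> weighted_tuples n \<and> tuple_size n \<kappa> = l.
       of_nat (fact l div (\<Prod>i=1..n. fact (\<kappa> i))) * (\<Prod>i=1..n. a i ^ \<kappa> i))"
proof -
  let ?C = "weak_compositions l {1..n}"
  let ?m = "\<lambda>\<kappa>. fact l div (\<Prod>i=1..n. fact (\<kappa> i)) :: nat"
  have "(tail_fps a ^ l) $ n = ((\<Sum>i\<in>{1..n}. fps_const (a i) * fps_X ^ i) ^ l) $ n"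
    by (rule fps_power_nth_cong[OF _ order.refl])
       (auto simp: tail_fps_def fps_sum_nth fps_X_power_nth if_distrib cong: if_cong)
  also have "\<dots> = (\<Sum>\<kappa>\<in>?C. (of_nat (?m \<kappa>) * (\<Prod>i=1..n. (fps_const (a i) * fps_X ^ i) ^ \<kappa> i)) $ n)"
    by (simp add: multinomial_theorem fps_sum_nth)
  also have "\<dots> = (\<Sum>\<kappa>\<in>?C. if (\<Sum>i=1..n. i * \<kappa> i) = n
      then of_nat (?m \<kappa>) * (\<Prod>i=1..n. a i ^ \<kappa> i) else 0)"
  proof (intro sum.cong refl)
    fix \<kappa>
    have "(\<Prod>i=1..n. (fps_const (a i) * fps_X ^ i) ^ \<kappa> i) =
        fps_const (\<Prod>i=1..n. a i ^ \<kappa> i) * fps_X ^ (\<Sum>i=1..n. i * \<kappa> i)"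
      by (simp add: power_mult_distrib prod.distrib fps_const_prod power_sum
            flip: power_mult)
    then have "of_nat (?m \<kappa>) * (\<Prod>i=1..n. (fps_const (a i) * fps_X ^ i) ^ \<kappa> i) =
        fps_const (of_nat (?m \<kappa>) * (\<Prod>i=1..n. a i ^ \<kappa> i)) * fps_X ^ (\<Sum>i=1..n. i * \<kappa> i)"
      by (simp add: fps_of_nat[symmetric] mult.assoc flip: fps_const_mult)
    then show "(of_nat (?m \<kappa>) * (\<Prod>i=1..n. (fps_const (a i) * fps_X ^ i) ^ \<kappa> i)) $ n =
      (if (\<Sum>i=1..n. i * \<kappa> i) = n then of_nat (?m \<kappa>) * (\<Prod>i=1..n. a i ^ \<kappa> i) else 0)"
      by (simp only: fps_mult_left_const_nth fps_X_power_nth) auto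
  qed
  also have "\<dots> = (\<Sum>\<kappa> | \<kappa> \<in> weighted_tuples n \<and> tuple_size n \<kappa> = l.
       of_nat (?m \<kappa>) * (\<Prod>i=1..n. a i ^ \<kappa> i))"
    by (subst sum.inter_filter[OF finite_weak_compositions, symmetric])
       (auto simp: weak_compositions_def weighted_tuples_def tuple_size_def
          intro!: sum.cong)
  finally show ?thesis .
qed

lemma sum_weighted_tuples_by_size:
  "(\<Sum>\<kappa>\<in>weighted_tuples n. g \<kappa>) =
    (\<Sum>l\<le>n. \<Sum>\<kappa> | \<kappa> \<in> weighted_tuples n \<and> tuple_size n \<kappa> = l. g \<kappa>)"
  by (rule sum.group[symmetric]) (auto simp: finite_weighted_tuples tuple_size_le)

section \<open>Integer binomial coefficients\<close>

lemma fact_mult_int_binom: "fact p * int_binom k (int p) = (\<Prod>j<p. k - int j)"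
proof -
  have "fact p dvd (\<Prod>j<p. k - int j)"
    using dvdI[OF gbinomial_int_mult_fact[symmetric], of p k] by (simp add: atLeast0LessThan)
  then show ?thesis by (simp add: int_binom_def)
qed

lemma int_binom_0 [simp]: "int_binom k 0 = 1"
  by (simp add: int_binom_def)

lemma int_binom_0_left: "int_binom 0 (int p) = (if p = 0 then 1 else 0)"
proof -
  have "fact p * int_binom 0 (int p) = 0" if "p > 0"
    unfolding fact_mult_int_binom using that by (intro prod_zero) auto
  then show ?thesis by auto
qed

text \<open>Pascal's rule for an upper argument of either sign, checked after multiplication by the
  factorial, where it becomes an identity between falling factorials.\<close>

lemma int_binom_Suc:
  "int_binom (k + 1) (int (Suc p)) = int_binom k (int (Suc p)) + int_binom k (int p)"
proof -
  have "fact (Suc p) * int_binom (k + 1) (int (Suc p)) = (k + 1) * (\<Prod>j<p. k - int j)"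
    unfolding fact_mult_int_binom prod.lessThan_Suc_shift by simp
  also have "\<dots> = (\<Prod>j<p. k - int j) * (k - int p) + int (Suc p) * (\<Prod>j<p. k - int j)"
    by (simp add: algebra_simps)
  also have "\<dots> = fact (Suc p) * int_binom k (int (Suc p)) + int (Suc p) * (fact p * int_binom k (int p))"
    unfolding fact_mult_int_binom by simp
  also have "\<dots> = fact (Suc p) * (int_binom k (int (Suc p)) + int_binom k (int p))"
    by (simp add: algebra_simps)
  finally show ?thesis by simp
qed

section \<open>Integer powers and evaluation of Laurent polynomials\<close>

lemma unit_powi_0 [simp]: "unit_powi x 0 = 1"
  by (simp add: unit_powi_def)

lemma unit_powi_add_1:
  assumes "x dvd 1"
  shows "unit_powi x (k + 1) = x * unit_powi x k"
proof (cases "k \<ge> 0")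
  case True
  then have "nat (k + 1) = Suc (nat k)" by simp
  then show ?thesis using True by (simp add: unit_powi_def)
next
  case False
  then have "nat (- k) = Suc (nat (- (k + 1)))" by simp
  then have "x * unit_powi x k = x * unit_inv x * unit_inv x ^ nat (- (k + 1))"
    using False by (simp add: unit_powi_def mult.assoc)
  also have "\<dots> = unit_powi x (k + 1)"
    using False unit_inv_right[OF assms] by (auto simp: unit_powi_def)
  finally show ?thesis by simp
qed

text \<open>Integer powers are determined by their value at \<open>0\<close> and the step \<open>k \<mapsto> k + 1\<close>. That \<open>x\<close> is a
  unit is a consequence of the step at \<open>-1\<close>, and it lets the step be undone for negative
  exponents.\<close>

lemma unit_powi_unique:
  fixes x :: "'a::comm_ring_1"
  assumes zero: "F 0 = 1" and step: "\<And>k. F (k + 1) = x * F k"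
  shows "F k = unit_powi x k"
proof -
  have inv: "x * F (-1) = 1"
    using step[of "-1"] zero by simp
  then have unit: "x dvd 1"
    by (metis dvd_triv_left)
  show ?thesis
  proof (induction k rule: int_induct[where k = 0])
    case base
    show ?case by (simp add: zero)
  next
    case (step1 i)
    then show ?case by (simp add: step unit_powi_add_1[OF unit])
  next
    case (step2 i)
    have "x * F (i - 1) = x * unit_powi x (i - 1)"
      using step2 step[of "i - 1"] unit_powi_add_1[OF unit, of "i - 1"] by simp
    then have "F (-1) * x * F (i - 1) = F (-1) * x * unit_powi x (i - 1)"
      by (simp only: mult.assoc)
    then show ?case
      using inv by (simp add: mult.commute)
  qed
qed

lemma laurent_eval_superset:
  assumes "finite A" "Poly_Mapping.keys f \<subseteq> A"
  shows "laurent_eval f x = (\<Sum>e\<in>A. Poly_Mapping.lookup f e * unit_powi x e)"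
  unfolding laurent_eval_def
  by (rule sum.mono_neutral_left) (use assms in \<open>auto simp: in_keys_iff\<close>)

lemma laurent_eval_single: "laurent_eval (Poly_Mapping.single e c) x = c * unit_powi x e"
  by (subst laurent_eval_superset[of "{e}"]) auto

lemma laurent_eval_add: "laurent_eval (f + g) x = laurent_eval f x + laurent_eval g x"
proof -
  let ?A = "Poly_Mapping.keys f \<union> Poly_Mapping.keys g"
  have "laurent_eval h x = (\<Sum>e\<in>?A. Poly_Mapping.lookup h e * unit_powi x e)"
    if "h \<in> {f, g, f + g}" for h
    using that keys_add[of f g] by (intro laurent_eval_superset) auto
  then show ?thesis
    by (simp add: lookup_add distrib_right sum.distrib)
qed

lemma laurent_eval_sum: "laurent_eval (\<Sum>i\<in>I. f i) x = (\<Sum>i\<in>I. laurent_eval (f i) x)"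
  by (induction I rule: infinite_finite_induct)
     (simp_all add: laurent_eval_add, simp_all add: laurent_eval_def)

section \<open>The binomial series\<close>

text \<open>The coefficient of $X^n$ in $\sum_l \binom{k}{l} a_0^{k-l} T^l$, the binomial expansion of
  $(a_0 + T)^k$.\<close>

definition binomial_series_coeff :: "(nat \<Rightarrow> 'a::comm_ring_1) \<Rightarrow> int \<Rightarrow> nat \<Rightarrow> 'a" where
  "binomial_series_coeff a k n =
    (\<Sum>l\<le>n. of_int (int_binom k (int l)) * (tail_fps a ^ l) $ n * unit_powi (a 0) (k - int l))"

text \<open>The exponent of $X$ in a term of $\mathcal{X}_n$ is $i = n - l$, so the lower index
  $n - i$ of the binomial coefficient in the bracket is the exponent \<open>l\<close> of $T$.\<close>

lemma laurent_eval_bracket_calX: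
  "laurent_eval (bracket k (int n) (calX a n)) (a 0) = binomial_series_coeff a k n"
proof -
  let ?c = "\<lambda>l. (tail_fps a ^ l) $ n"
  have coeff: "poly.coeff (calX a n) i = ?c (n - i)" if "i \<le> n" for i
  proof -
    have "poly.coeff (calX a n) i = (\<Sum>l\<le>n. if l = n - i then ?c l else 0)"
      unfolding calX_eq_sum coeff_sum using that by (intro sum.cong) auto
    then show ?thesis by simp
  qed
  have "degree (calX a n) \<le> n"
    unfolding calX_eq_sum
    by (intro degree_sum_le) (auto intro: order.trans[OF degree_monom_le])
  then have "laurent_eval (bracket k (int n) (calX a n)) (a 0) =
      (\<Sum>i\<le>n. poly.coeff (calX a n) i * of_int (int_binom k (int n - int i)) *
         unit_powi (a 0) (k - (int n - int i)))"
    by (simp add: bracket_altdef[of _ n] laurent_eval_sum laurent_eval_single)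
  also have "\<dots> = binomial_series_coeff a k n"
    unfolding binomial_series_coeff_def
    by (rule sum.reindex_bij_witness[where i = "\<lambda>l. n - l" and j = "\<lambda>i. n - i"])
       (auto simp: coeff of_nat_diff mult_ac)
  finally show ?thesis .
qed

text \<open>A common upper bound makes the expansions for different \<open>n\<close> comparable term by term.\<close>

lemma binomial_series_coeff_upto:
  assumes "n \<le> N"
  shows "binomial_series_coeff a k n =
    (\<Sum>l\<le>N. of_int (int_binom k (int l)) * (tail_fps a ^ l) $ n * unit_powi (a 0) (k - int l))"
  unfolding binomial_series_coeff_def
  by (rule sum.mono_neutral_left) (use assms in \<open>auto simp: tail_fps_power_nth_eq_0\<close>)

lemma Abs_fps_binomial_series_coeff_0: "Abs_fps (binomial_series_coeff a 0) = 1"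
proof -
  have "binomial_series_coeff a 0 n = (\<Sum>l\<le>n. if l = 0 then (1 :: 'a fps) $ n else 0)" for n
    unfolding binomial_series_coeff_def by (intro sum.cong) (auto simp: int_binom_0_left)
  then show ?thesis by (simp add: fps_eq_iff)
qed

text \<open>Multiplying the binomial series by $a_0 + T$ gives two copies of it: the factor $a_0$ raises
  the exponent of $a_0$, and the factor $T$ shifts \<open>l\<close>. Pascal's rule adds them up. The unit
  $a_0$ is needed to combine $a_0$ with its negative powers.\<close>

lemma Abs_fps_binomial_series_coeff_add_1:
  assumes "a 0 dvd 1"
  shows "Abs_fps (binomial_series_coeff a (k + 1)) = Abs_fps a * Abs_fps (binomial_series_coeff a k)"
proof (rule fps_ext)
  fix n
  let ?B = "\<lambda>k l. of_int (int_binom k (int l)) :: 'a"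
  let ?c = "\<lambda>n l. (tail_fps a ^ l) $ n"
  let ?u = "\<lambda>l. unit_powi (a 0) (k + 1 - int l)"
  have u: "a 0 * unit_powi (a 0) (k - int l) = ?u l" for l
    using unit_powi_add_1[OF assms, of "k - int l"] by (simp add: algebra_simps)
  have const: "a 0 * binomial_series_coeff a k n = (\<Sum>l\<le>Suc n. ?B k l * ?c n l * ?u l)"
    unfolding binomial_series_coeff_upto[of n "Suc n", OF le_SucI[OF order.refl]] sum_distrib_left
    by (intro sum.cong refl) (simp add: u[symmetric] mult_ac)
  have "(tail_fps a * Abs_fps (binomial_series_coeff a k)) $ n =
      (\<Sum>i=0..n. tail_fps a $ i * (\<Sum>l\<le>n. ?B k l * ?c (n - i) l * ?u (Suc l)))"
    by (simp add: fps_mult_nth binomial_series_coeff_upto[of _ n])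
  also have "\<dots> = (\<Sum>l\<le>n. \<Sum>i=0..n. ?B k l * (tail_fps a $ i * ?c (n - i) l) * ?u (Suc l))"
    unfolding sum_distrib_left by (subst sum.swap) (simp add: mult_ac)
  also have "\<dots> = (\<Sum>l\<le>n. ?B k l * ?c n (Suc l) * ?u (Suc l))"
    by (simp add: fps_mult_nth sum_distrib_left sum_distrib_right)
  finally have tail: "(tail_fps a * Abs_fps (binomial_series_coeff a k)) $ n =
      (\<Sum>l\<le>n. ?B k l * ?c n (Suc l) * ?u (Suc l))" .
  have "Abs_fps (binomial_series_coeff a (k + 1)) $ n = (\<Sum>l\<le>Suc n. ?B (k + 1) l * ?c n l * ?u l)"
    by (simp only: fps_nth_Abs_fps binomial_series_coeff_upto[of n "Suc n", OF le_SucI[OF order.refl]])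
  also have "\<dots> = ?c n 0 * ?u 0 +
      (\<Sum>l\<le>n. (?B k (Suc l) + ?B k l) * ?c n (Suc l) * ?u (Suc l))"
    unfolding sum.atMost_Suc_shift int_binom_Suc by simp
  also have "\<dots> = (\<Sum>l\<le>Suc n. ?B k l * ?c n l * ?u l) +
      (\<Sum>l\<le>n. ?B k l * ?c n (Suc l) * ?u (Suc l))"
    unfolding sum.atMost_Suc_shift distrib_right sum.distrib by simp
  also have "\<dots> = (Abs_fps a * Abs_fps (binomial_series_coeff a k)) $ n"
    unfolding Abs_fps_eq_const_plus_tail[of a] distrib_right fps_add_nth tail
    by (simp only: const[symmetric] fps_mult_left_const_nth fps_nth_Abs_fps)
  finally show "Abs_fps (binomial_series_coeff a (k + 1)) $ n =
      (Abs_fps a * Abs_fps (binomial_series_coeff a k)) $ n" .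
qed

text \<open>The explicit coefficient $k(k-1)\cdots(k-l+1) / (k_1! \cdots k_n!)$ is an integer because it
  is the product of two integers.\<close>

lemma int_binom_times_multinomial:
  assumes "tuple_size n \<kappa> = l"
  shows "int_binom k (int l) * int (fact l div (\<Prod>i=1..n. fact (\<kappa> i))) =
    (\<Prod>j<l. k - int j) div (\<Prod>i=1..n. fact (\<kappa> i))"
proof -
  obtain m where m: "fact l = (\<Prod>i=1..n. fact (\<kappa> i)) * (m :: nat)"
    using prod_fact_dvd_fact_sum[of "{1..n}" \<kappa>] assms by (auto simp: tuple_size_def dvd_def)
  have "(fact l :: int) = int (fact l)" by simp
  also have "\<dots> = (\<Prod>i=1..n. fact (\<kappa> i)) * int m" unfolding m by simp
  finally have "(\<Prod>j<l. k - int j) = (\<Prod>i=1..n. fact (\<kappa> i)) * (int m * int_binom k (int l))"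
    by (simp flip: fact_mult_int_binom)
  moreover have "(\<Prod>i=1..n. fact (\<kappa> i) :: int) \<noteq> 0" "(\<Prod>i=1..n. fact (\<kappa> i) :: nat) \<noteq> 0" by simp_all
  ultimately show ?thesis unfolding m by simp
qed

theorem theorem1p1:
  fixes a :: "nat \<Rightarrow> 'a::comm_ring_1"
  assumes "a 0 dvd 1"
  shows "(\<forall>k::int. unit_powi (Abs_fps a) k =
            Abs_fps (\<lambda>i. laurent_eval (bracket k (int i) (calX a i)) (a 0)))
    \<and> (\<forall>n\<ge>1. delta_poly a n =
            (\<Sum>\<kappa>\<in>weighted_tuples n.
               let l = tuple_size n \<kappa> in
               monom (of_nat (fact l div (\<Prod>i=1..n. fact (\<kappa> i))) * (\<Prod>i=1..n. a i ^ \<kappa> i)) (n - l)))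
    \<and> (\<forall>n\<ge>1. \<forall>k::int. laurent_eval (bracket k (int n) (calX a n)) (a 0) =
            (\<Sum>\<kappa>\<in>weighted_tuples n.
               let l = tuple_size n \<kappa> in
               of_int ((\<Prod>j<l. k - int j) div (\<Prod>i=1..n. fact (\<kappa> i)))
                 * (\<Prod>i=1..n. a i ^ \<kappa> i) * unit_powi (a 0) (k - int l)))"
proof (intro conjI allI impI)
  fix k :: int
  show "unit_powi (Abs_fps a) k =
      Abs_fps (\<lambda>i. laurent_eval (bracket k (int i) (calX a i)) (a 0))"
    unfolding laurent_eval_bracket_calX
    by (rule unit_powi_unique[where F = "\<lambda>k. Abs_fps (binomial_series_coeff a k)", symmetric])
       (simp_all only: Abs_fps_binomial_series_coeff_0 Abs_fps_binomial_series_coeff_add_1[of a, OF assms])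
next
  fix n :: nat
  assume "n \<ge> 1"
  then have "delta_poly a n = calX a n" by (simp add: calX_def)
  then show "delta_poly a n = (\<Sum>\<kappa>\<in>weighted_tuples n.
      let l = tuple_size n \<kappa> in
      monom (of_nat (fact l div (\<Prod>i=1..n. fact (\<kappa> i))) * (\<Prod>i=1..n. a i ^ \<kappa> i)) (n - l))"
    unfolding sum_weighted_tuples_by_size calX_eq_sum tail_fps_power_nth Let_def
    by (simp add: monom_sum)
next
  fix n :: nat and k :: int
  show "laurent_eval (bracket k (int n) (calX a n)) (a 0) = (\<Sum>\<kappa>\<in>weighted_tuples n.
      let l = tuple_size n \<kappa> in
      of_int ((\<Prod>j<l. k - int j) div (\<Prod>i=1..n. fact (\<kappa> i)))
        * (\<Prod>i=1..n. a i ^ \<kappa> i) * unit_powi (a 0) (k - int l))"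
    unfolding laurent_eval_bracket_calX binomial_series_coeff_def sum_weighted_tuples_by_size Let_def
  proof (intro sum.cong refl, goal_cases)
    case (1 l)
    have "(of_int ((\<Prod>j<l. k - int j) div (\<Prod>i=1..n. fact (\<kappa> i))) :: 'a) =
        of_int (int_binom k (int l)) * of_nat (fact l div (\<Prod>i=1..n. fact (\<kappa> i)))"
      if "tuple_size n \<kappa> = l" for \<kappa>
      unfolding int_binom_times_multinomial[OF that, symmetric] by simp
    then show ?case
      unfolding tail_fps_power_nth sum_distrib_left sum_distrib_right
      by (intro sum.cong refl) (auto simp: mult_ac)
  qed
qed

end
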